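(* Let $d\ge1$, $a>0$, $b\in\mathbb{R}^d$ and $\sigma=\sqrt{2a}$. Let $D\subset\mathbb{R}^d$ be a nonempty bounded open set and let $f:\partial D\to\mathbb{R}$ be a continuous function. There exists at most one continuous function $u:\overline D\to\mathbb{R}$ such that $u|_{\partial D}=f$ and $u$ is of class $C^2$ in $D$ and satisfies $$\frac{\sigma^2}{2}\Delta u(x)+b\cdot\nabla u(x)=0,\qquad\forall x\in D.$$
   Context: $\overline D$ and $\partial D$ denote the closure and the boundary of $D$. *)

theory Defs
  imports "HOL-Analysis.Analysis"
begin

definition partial_deriv :: "'n::finite \<Rightarrow> (real ^ 'n \<Rightarrow> real) \<Rightarrow> real ^ 'n \<Rightarrow> real" where
  "partial_deriv i g x = deriv (\<lambda>t. g (x + t *\<^sub>R axis i 1)) 0"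

text \<open>
  The \<^const>\<open>deriv\<close> of a function that is not differentiable is an arbitrary value, so existence of
  the partial derivatives is required separately below. For an open set \<open>D\<close>, both predicates
  and the values of the operators on \<open>D\<close> depend only on the restriction of \<open>g\<close> to \<open>D\<close>.
\<close>

definition C1_on :: "(real ^ 'n::finite) set \<Rightarrow> (real ^ 'n \<Rightarrow> real) \<Rightarrow> bool" where
  "C1_on D g \<longleftrightarrow> continuous_on D g \<and>
     (\<forall>i. (\<forall>x\<in>D. (\<lambda>t. g (x + t *\<^sub>R axis i 1)) field_differentiable (at 0)) \<and>
          continuous_on D (partial_deriv i g))"

definition C2_on :: "(real ^ 'n::finite) set \<Rightarrow> (real ^ 'n \<Rightarrow> real) \<Rightarrow> bool" where
  "C2_on D g \<longleftrightarrow> C1_on D g \<and> (\<forall>i. C1_on D (partial_deriv i g))"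

definition grad :: "(real ^ 'n::finite \<Rightarrow> real) \<Rightarrow> real ^ 'n \<Rightarrow> real ^ 'n" where
  "grad g x = (\<chi> i. partial_deriv i g x)"

definition laplacian :: "(real ^ 'n::finite \<Rightarrow> real) \<Rightarrow> real ^ 'n \<Rightarrow> real" where
  "laplacian g x = (\<Sum>i\<in>UNIV. partial_deriv i (partial_deriv i g) x)"

end

theory Submission
  imports Defs
begin

text \<open>
  Weak maximum principle. The difference of two solutions is perturbed by a small multiple of
  \<open>exp (\<lambda> * x $ i)\<close>, which is a strict subsolution once \<open>a * \<lambda> + b $ i > 0\<close>. At an interior
  maximum of the perturbed function all first partial derivatives vanish and all pure second ones
  are nonpositive, which contradicts strictness; so the difference is bounded by its boundary
  values up to an error that vanishes with the perturbation.
\<close>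

lemma second_derivative_nonpos_at_local_max:
  fixes g g' :: "real \<Rightarrow> real"
  assumes "0 < r"
    and g: "\<And>t. \<bar>t\<bar> < r \<Longrightarrow> (g has_real_derivative g' t) (at t)"
    and g': "(g' has_real_derivative m) (at 0)"
    and max: "\<And>t. \<bar>t\<bar> < r \<Longrightarrow> g t \<le> g 0"
  shows "g' 0 = 0" and "m \<le> 0"
proof -
  show g'0: "g' 0 = 0"
    by (rule DERIV_local_max[OF g \<open>0 < r\<close>]) (use max \<open>0 < r\<close> in auto)
  show "m \<le> 0"
  proof (rule ccontr)
    \<comment> \<open>A positive \<open>m\<close> together with \<open>g' 0 = 0\<close> makes
      \<open>g'\<close> positive just to the right of 0. The mean value theorem then gives a point
      \<open>t\<close> with \<open>g t > g 0\<close>, against maximality. Only differentiability of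
      \<open>g'\<close> at the single point 0 enters.\<close>
    assume "\<not> m \<le> 0"
    then obtain d where d: "0 < d" "\<And>h. 0 < h \<Longrightarrow> h < d \<Longrightarrow> g' 0 < g' (0 + h)"
      using DERIV_pos_inc_right[OF g'] by auto
    define t where "t = min d r / 2"
    have t: "0 < t" "t < d" "t < r"
      using d(1) \<open>0 < r\<close> by (auto simp: t_def)
    obtain z where "0 < z" "z < t" "g t - g 0 = (t - 0) * g' z"
      using MVT2[OF t(1), of g g'] g t(3) by auto
    moreover have "0 < g' z"
      using d(2)[of z] g'0 \<open>0 < z\<close> \<open>z < t\<close> t by simp
    ultimately have "g 0 < g t"
      using t(1) by (metis diff_gt_0_iff_gt diff_zero mult_pos_pos)
    with max[of t] t show False by simp
  qed
qed

text \<open>The definition of \<open>C1_on\<close> differentiates at parameter 0 from each base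
  point. Moving the base point along the coordinate line turns this into a derivative at any
  parameter \<open>s\<close>, as needed to differentiate the restriction of a function to that line
  twice.\<close>

lemma C1_on_has_partial_deriv:
  fixes g :: "real ^ 'n::finite \<Rightarrow> real"
  assumes "C1_on D g" and "x + s *\<^sub>R axis i 1 \<in> D"
  shows "((\<lambda>t. g (x + t *\<^sub>R axis i 1)) has_real_derivative
          partial_deriv i g (x + s *\<^sub>R axis i 1)) (at s)"
proof -
  let ?y = "x + s *\<^sub>R axis i 1"
  have shift: "(\<lambda>t. g (x + t *\<^sub>R axis i 1)) = (\<lambda>t. g (?y + (t - s) *\<^sub>R axis i 1))"
    by (simp add: scaleR_left_diff_distrib)
  have "((\<lambda>t. g (?y + t *\<^sub>R axis i 1)) has_real_derivative partial_deriv i g ?y) (at 0)"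
    using assms by (simp add: C1_on_def partial_deriv_def DERIV_deriv_iff_field_differentiable)
  then show ?thesis
    unfolding shift
    using DERIV_shift[of "\<lambda>t. g (?y + (t - s) *\<^sub>R axis i 1)" "partial_deriv i g ?y" 0 s]
    by simp
qed

text \<open>Restricting to the line through \<open>y\<close> in direction \<open>j\<close> reduces
  the claim to the one-variable derivative tests. Here \<open>\<delta> j\<close> is the Kronecker
  delta of \<open>j\<close> and \<open>i\<close>, so one formula covers all directions although the
  perturbation varies only in direction \<open>i\<close>.\<close>

lemma perturbed_difference_interior_max:
  fixes u v :: "real ^ 'n::finite \<Rightarrow> real"
  assumes "open D" and u: "C2_on D u" and v: "C2_on D v" and "y \<in> D"
    and max: "\<And>x. x \<in> D \<Longrightarrow>
      u x - v x + \<epsilon> * exp (l * x $ i) \<le> u y - v y + \<epsilon> * exp (l * y $ i)"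
  defines "\<delta> \<equiv> \<lambda>j. axis j (1::real) $ i"
  shows "partial_deriv j u y - partial_deriv j v y + \<epsilon> * (l * \<delta> j * exp (l * y $ i)) = 0"
    and "partial_deriv j (partial_deriv j u) y - partial_deriv j (partial_deriv j v) y
          + \<epsilon> * ((l * \<delta> j)\<^sup>2 * exp (l * y $ i)) \<le> 0"
proof -
  obtain r where r: "0 < r" "ball y r \<subseteq> D"
    using \<open>open D\<close> \<open>y \<in> D\<close> open_contains_ball by blast
  have line: "y + t *\<^sub>R axis j 1 \<in> D" if "\<bar>t\<bar> < r" for t
    using r(2) that by (auto simp: subset_iff dist_norm norm_axis_1)
  note C1 = u[unfolded C2_on_def, THEN conjunct1] v[unfolded C2_on_def, THEN conjunct1]
  note C1' = u[unfolded C2_on_def, THEN conjunct2, rule_format, of j]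
    v[unfolded C2_on_def, THEN conjunct2, rule_format, of j]
  let ?x = "\<lambda>t. y + t *\<^sub>R axis j 1"
  let ?g = "\<lambda>t. u (?x t) - v (?x t) + \<epsilon> * exp (l * ?x t $ i)"
  let ?g' = "\<lambda>t. partial_deriv j u (?x t) - partial_deriv j v (?x t)
    + \<epsilon> * (l * \<delta> j * exp (l * ?x t $ i))"
  let ?m = "partial_deriv j (partial_deriv j u) (?x 0) - partial_deriv j (partial_deriv j v) (?x 0)
    + \<epsilon> * ((l * \<delta> j)\<^sup>2 * exp (l * ?x 0 $ i))"
  have E: "((\<lambda>t. exp (l * ?x t $ i)) has_real_derivative l * \<delta> j * exp (l * ?x t $ i)) (at t)" for t
    unfolding \<delta>_def by (auto intro!: derivative_eq_intros)
  have g: "(?g has_real_derivative ?g' t) (at t)" if "\<bar>t\<bar> < r" for t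
    using C1_on_has_partial_deriv[OF C1(1) line[OF that]]
      C1_on_has_partial_deriv[OF C1(2) line[OF that]] E
    by (intro DERIV_add DERIV_diff DERIV_cmult)
  have "y + 0 *\<^sub>R axis j 1 \<in> D"
    using \<open>y \<in> D\<close> by simp
  note C1_on_has_partial_deriv[OF C1'(1) this] C1_on_has_partial_deriv[OF C1'(2) this]
  then have "(?g' has_real_derivative partial_deriv j (partial_deriv j u) (?x 0)
      - partial_deriv j (partial_deriv j v) (?x 0)
      + \<epsilon> * (l * \<delta> j * (l * \<delta> j * exp (l * ?x 0 $ i)))) (at 0)"
    using E by (intro DERIV_add DERIV_diff DERIV_cmult)
  then have g': "(?g' has_real_derivative ?m) (at 0)"
    by (simp add: power2_eq_square mult.assoc)
  have le: "?g t \<le> ?g 0" if "\<bar>t\<bar> < r" for t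
    using max[OF line[OF that]] by simp
  show "partial_deriv j u y - partial_deriv j v y + \<epsilon> * (l * \<delta> j * exp (l * y $ i)) = 0"
    using second_derivative_nonpos_at_local_max(1)[OF r(1) g g' le] by simp
  show "partial_deriv j (partial_deriv j u) y - partial_deriv j (partial_deriv j v) y
          + \<epsilon> * ((l * \<delta> j)\<^sup>2 * exp (l * y $ i)) \<le> 0"
    using second_derivative_nonpos_at_local_max(2)[OF r(1) g g' le] by simp
qed

text \<open>The inequalities are one-sided so that two solutions with equal boundary values can be
  compared in both orders. The drift \<open>b\<close> may have any sign, since the exponential
  perturbation is chosen steep enough to dominate it.\<close>

lemma elliptic_comparison:
  fixes u v :: "real ^ 'n::finite \<Rightarrow> real"
  assumes "0 < a" and "bounded D" and "open D"
    and cont: "continuous_on (closure D) u" "continuous_on (closure D) v"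
    and bdry: "\<And>x. x \<in> frontier D \<Longrightarrow> u x \<le> v x"
    and C2: "C2_on D u" "C2_on D v"
    and eq: "\<And>x. x \<in> D \<Longrightarrow> a * laplacian v x + b \<bullet> grad v x \<le> a * laplacian u x + b \<bullet> grad u x"
    and "z \<in> closure D"
  shows "u z \<le> v z"
proof (rule ccontr)
  assume "\<not> u z \<le> v z"
  then have pos: "0 < u z - v z" by simp
  have comp: "compact (closure D)"
    using \<open>bounded D\<close> by (simp add: compact_closure)
  have ne: "closure D \<noteq> {}"
    using \<open>z \<in> closure D\<close> by auto
  \<comment> \<open>Types are nonempty, so the dimension is at least 1 and some coordinate
    exists.\<close>
  obtain i :: 'n where True by blast
  \<comment> \<open>With this choice \<open>a * l + b $ i = \<bar>b $ i\<bar> + 1 + b $ i\<close>,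
    which is at least 1.\<close>
  define l where "l = (\<bar>b $ i\<bar> + 1) / a"
  have "0 < l"
    using \<open>0 < a\<close> by (simp add: l_def add_nonneg_pos)
  have "a * l + b $ i > 0"
    using \<open>0 < a\<close> by (simp add: l_def)
  have contE: "continuous_on (closure D) (\<lambda>x. exp (l * x $ i))"
    by (intro continuous_intros)
  obtain k where k: "k \<in> closure D" "\<And>x. x \<in> closure D \<Longrightarrow> exp (l * x $ i) \<le> exp (l * k $ i)"
    using continuous_attains_sup[OF comp ne contE] by metis
  define M where "M = exp (l * k $ i)"
  have "0 < M" by (simp add: M_def)
  \<comment> \<open>The perturbation is at most half the assumed gap at \<open>z\<close> throughout
    the closure. On the frontier \<open>u - v\<close> is nonpositive, so \<open>h\<close> stays
    below the gap there, while \<open>h z\<close> is at least the gap; the maximum of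
    \<open>h\<close> is therefore interior.\<close>
  define \<epsilon> where "\<epsilon> = (u z - v z) / (2 * M)"
  have "0 < \<epsilon>" and \<epsilon>M: "\<epsilon> * M < u z - v z"
    using pos \<open>0 < M\<close> by (auto simp: \<epsilon>_def)
  define h where "h = (\<lambda>x. u x - v x + \<epsilon> * exp (l * x $ i))"
  have "continuous_on (closure D) h"
    unfolding h_def by (intro continuous_intros cont)
  then obtain y where y: "y \<in> closure D" "\<And>x. x \<in> closure D \<Longrightarrow> h x \<le> h y"
    using continuous_attains_sup[OF comp ne] by metis
  have "y \<notin> frontier D"
  proof
    assume "y \<in> frontier D"
    then have "h y \<le> \<epsilon> * M"
      using add_mono[OF bdry mult_left_mono[OF k(2)[OF y(1)], of \<epsilon>], of y] \<open>0 < \<epsilon>\<close>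
      by (simp add: h_def M_def)
    moreover have "u z - v z \<le> h z"
      using \<open>0 < \<epsilon>\<close> by (simp add: h_def)
    ultimately show False
      using y(2)[OF \<open>z \<in> closure D\<close>] \<epsilon>M by linarith
  qed
  then have "y \<in> D"
    using y(1) \<open>open D\<close> by (simp add: frontier_def interior_open)
  have max: "u x - v x + \<epsilon> * exp (l * x $ i) \<le> u y - v y + \<epsilon> * exp (l * y $ i)" if "x \<in> D" for x
    using y(2)[of x] that closure_subset[of D] by (auto simp: h_def)
  note derivs = perturbed_difference_interior_max[OF \<open>open D\<close> C2 \<open>y \<in> D\<close> max]
  let ?E = "exp (l * y $ i)"
  \<comment> \<open>The gradient of \<open>u - v\<close> at \<open>y\<close> cancels that of the
    perturbation, so only coordinate \<open>i\<close> survives and the drift term can be computed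
    exactly.\<close>
  have first: "partial_deriv j u y - partial_deriv j v y
      = - (if j = i then \<epsilon> * (l * ?E) else 0)" for j
    using derivs(1)[of j] by (auto simp: axis_def split: if_splits)
  have second: "partial_deriv j (partial_deriv j u) y - partial_deriv j (partial_deriv j v) y
      \<le> - (if j = i then \<epsilon> * (l\<^sup>2 * ?E) else 0)" for j
    using derivs(2)[of j] by (auto simp: axis_def split: if_splits)
  have "b \<bullet> grad u y - b \<bullet> grad v y
      = (\<Sum>j\<in>UNIV. b $ j * (partial_deriv j u y - partial_deriv j v y))"
    by (simp add: inner_vec_def grad_def sum_subtractf right_diff_distrib)
  also have "\<dots> = - (b $ i * (\<epsilon> * (l * ?E)))"
    by (simp add: first sum_negf if_distrib[of "\<lambda>x. _ * x"] sum.delta cong: if_cong)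
  finally have grad: "b \<bullet> grad u y - b \<bullet> grad v y = - (b $ i * (\<epsilon> * (l * ?E)))" .
  have "laplacian u y - laplacian v y \<le> (\<Sum>j\<in>UNIV. - (if j = i then \<epsilon> * (l\<^sup>2 * ?E) else 0))"
    unfolding laplacian_def sum_subtractf[symmetric] by (intro sum_mono second)
  also have "\<dots> = - (\<epsilon> * (l\<^sup>2 * ?E))"
    by (simp add: sum_negf)
  finally have lap: "laplacian u y - laplacian v y \<le> - (\<epsilon> * (l\<^sup>2 * ?E))" .
  \<comment> \<open>The operator applied to \<open>u - v\<close> is nonnegative at \<open>y\<close>
    by \<open>eq\<close>, yet the conditions at the maximum bound it above by minus its value on the
    perturbation. That value is \<open>\<epsilon> * l * ?E * (a * l + b $ i)\<close>, which is
    positive.\<close>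
  have "0 \<le> a * (laplacian u y - laplacian v y) + (b \<bullet> grad u y - b \<bullet> grad v y)"
    using eq[OF \<open>y \<in> D\<close>] by (simp add: algebra_simps)
  also have "\<dots> \<le> a * (- (\<epsilon> * (l\<^sup>2 * ?E))) + - (b $ i * (\<epsilon> * (l * ?E)))"
    unfolding grad using lap \<open>0 < a\<close> by (intro add_right_mono mult_left_mono) auto
  also have "\<dots> = - (\<epsilon> * l * ?E * (a * l + b $ i))"
    by (simp add: algebra_simps power2_eq_square)
  also have "\<dots> < 0"
    using \<open>0 < \<epsilon>\<close> \<open>0 < l\<close> \<open>a * l + b $ i > 0\<close> by simp
  finally show False by simp
qed

theorem theorem3p7:
  fixes a \<sigma> :: real and b :: "real ^ 'n::finite"
    and D :: "(real ^ 'n) set" and f :: "real ^ 'n \<Rightarrow> real"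
  assumes "a > 0"
    and "\<sigma> = sqrt (2 * a)"
    and "D \<noteq> {}" and "bounded D" and "open D"
    and "continuous_on (frontier D) f"
  shows "\<exists>\<^sub>\<le>\<^sub>1 u. u \<in> extensional (closure D)
           \<and> continuous_on (closure D) u
           \<and> (\<forall>x\<in>frontier D. u x = f x)
           \<and> C2_on D u
           \<and> (\<forall>x\<in>D. \<sigma>\<^sup>2 / 2 * laplacian u x + b \<bullet> grad u x = 0)"
    (is "\<exists>\<^sub>\<le>\<^sub>1 u. ?P u")
proof (rule Uniq_I)
  fix u v assume u: "?P u" and v: "?P v"
  have \<sigma>: "\<sigma>\<^sup>2 / 2 = a"
    using assms(1,2) by simp
  have le: "u' z \<le> v' z" if "?P u'" "?P v'" "z \<in> closure D" for u' v' z
    by (rule elliptic_comparison[OF assms(1,4,5), where b = b]) (use that \<sigma> in auto)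
  show "u = v"
    \<comment> \<open>Comparison in both orders gives equality on the closure of \<open>D\<close>.
      Outside it, membership in \<open>extensional\<close> forces both total functions to take the
      same default value.\<close>
    using u v by (intro extensionalityI[of u "closure D" v] antisym le) auto
qed

end
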